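(* The maximum spectral radius $\lambda(n,3)$ of connected subcubic bipartite graphs on $n$ vertices satisfies $\lambda(n,3)=3-\Theta\!\left(\frac{\pi^{2}}{n^{2}}\right)$ as $n\to\infty$; that is, there exist constants $c_1,c_2>0$ and $n_0$ such that for all $n\ge n_0$, $$c_1\frac{\pi^{2}}{n^{2}}\le 3-\lambda(n,3)\le c_2\frac{\pi^{2}}{n^{2}}.$$
   Context: Graphs are finite and simple. The spectral radius $\rho(G)$ of a graph $G$ is the largest eigenvalue of its adjacency matrix. A graph is irregular if its vertices do not all have the same degree. A bipartite graph is called subcubic if it is irregular and has maximum degree three. $\lambda(n,3)=\max\{\rho(G): G\in\mathcal{B}(n,3)\}$, where $\mathcal{B}(n,3)$ is the set of all connected subcubic bipartite graphs on $n$ vertices. *)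

theory Defs
  imports
    "Graph_Theory.Graph_Theory"
    "Jordan_Normal_Form.Spectral_Radius"
begin

text \<open>
  A finite simple graph is a \<^locale>\<open>pair_graph\<close>: a finite digraph without loops whose arc
  relation is symmetric, each undirected edge being the pair of its two opposite arcs.
  The degree of a vertex is therefore its out-degree.
\<close>

abbreviation degree_in :: "'a pair_pre_digraph \<Rightarrow> 'a \<Rightarrow> nat" where
  "degree_in G v \<equiv> out_degree (with_proj G) v"

definition max_degree :: "'a pair_pre_digraph \<Rightarrow> nat" where
  "max_degree G = Max (degree_in G ` pverts G)"

definition irregular :: "'a pair_pre_digraph \<Rightarrow> bool" where
  "irregular G \<longleftrightarrow> (\<exists>u\<in>pverts G. \<exists>v\<in>pverts G. degree_in G u \<noteq> degree_in G v)"

definition bipartite :: "'a pair_pre_digraph \<Rightarrow> bool" where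
  "bipartite G \<longleftrightarrow> (\<exists>U W. pverts G = U \<union> W \<and> U \<inter> W = {} \<and>
     (\<forall>(u, v)\<in>parcs G. u \<in> U \<and> v \<in> W \<or> u \<in> W \<and> v \<in> U))"

definition subcubic_bipartite :: "'a pair_pre_digraph \<Rightarrow> bool" where
  "subcubic_bipartite G \<longleftrightarrow> pair_graph G \<and> bipartite G \<and> irregular G \<and> max_degree G = 3"

text \<open>
  Matrix indices start at 0, so the adjacency matrix is meaningful for graphs whose vertex set
  is an initial segment of the natural numbers; every finite graph is isomorphic to such a graph.
\<close>

definition adj_mat :: "nat pair_pre_digraph \<Rightarrow> real mat" where
  "adj_mat G = mat (card (pverts G)) (card (pverts G))
     (\<lambda>(i, j). if (i, j) \<in> parcs G then 1 else 0)"

text \<open>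
  The largest eigenvalue. The library's \<^const>\<open>spectral_radius\<close> is the largest modulus of
  a complex eigenvalue instead.
\<close>

definition rho :: "nat pair_pre_digraph \<Rightarrow> real" where
  "rho G = Max (spectrum (adj_mat G))"

text \<open>
  The set $\mathcal{B}(n,3)$, with vertices labelled by $0, \dots, n-1$. The qualified name
  distinguishes graph connectedness from topological connectedness.
\<close>

definition conn_subcubic_bipartite :: "nat \<Rightarrow> nat pair_pre_digraph set" where
  "conn_subcubic_bipartite n =
     {G. pverts G = {..<n} \<and> subcubic_bipartite G \<and> Digraph_Component.connected (with_proj G)}"

text \<open>
  The number $\lambda(n,3)$. It is the maximum of a finite set, which is empty
  (and the value then unspecified) only for $n < 4$; the star with three leaves is the
  smallest member.
\<close>

definition max_rho :: "nat \<Rightarrow> real" where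
  "max_rho n = Max (rho ` conn_subcubic_bipartite n)"

end

theory Submission
  imports Defs "HOL-Analysis.Convex"
begin

text \<open>
  Let \<open>\<lambda>\<close> be an eigenvalue with eigenvector \<open>x\<close>. The Laplacian form gives
  \<open>(3 - \<lambda>) \<parallel>x\<parallel>\<^sup>2 = \<Sum>\<^sub>v (3 - deg v) x\<^sub>v\<^sup>2 + \<Sum>\<^sub>u\<^sub>v (x\<^sub>u - x\<^sub>v)\<^sup>2\<close>, the last sum over edges. Along a path
  from a vertex of degree less than 3 to one where \<open>\<bar>x\<bar>\<close> is maximal, the Cauchy-Schwarz
  inequality bounds the right-hand side below by a multiple of \<open>\<parallel>x\<parallel>\<^sup>2 / n\<^sup>2\<close>.

  Conversely, take two ladders with \<open>m\<close> rungs, \<open>m\<close> about \<open>n / 4\<close>, and join them through the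
  first vertex of a short pendant path. The eigenvector \<open>sin (i \<pi> / (m + 1))\<close> of one ladder,
  its negative on the other and 0 on the path form an exact eigenvector for
  \<open>1 + 2 cos (\<pi> / (m + 1))\<close>. The antisymmetry allows any path length and hence any \<open>n\<close>,
  and no monotonicity of the spectral radius is needed.
\<close>

section \<open>Eigenvalues in coordinates, and real symmetric matrices\<close>

text \<open>Eigenvectors become plain functions on indices. The entries are generic because the
  lemma serves both real and complex matrices.\<close>

lemma eigenvalue_mat_iff:
  fixes a :: "nat \<Rightarrow> nat \<Rightarrow> 'a :: comm_ring_1"
  shows "eigenvalue (mat n n (\<lambda>(i, j). a i j)) k \<longleftrightarrow>
    (\<exists>x. (\<exists>i<n. x i \<noteq> 0) \<and> (\<forall>i<n. (\<Sum>j<n. a i j * x j) = k * x i))"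
    (is "eigenvalue ?A k \<longleftrightarrow> ?R")
proof -
  have mult: "(?A *\<^sub>v v) $ i = (\<Sum>j<n. a i j * v $ j)"
    if "i < n" "v \<in> carrier_vec n" for v i
    using that by (auto simp: scalar_prod_def atLeast0LessThan)
  show ?thesis
  proof
    assume "eigenvalue ?A k"
    then obtain v where v: "v \<in> carrier_vec n" "v \<noteq> 0\<^sub>v n" "?A *\<^sub>v v = k \<cdot>\<^sub>v v"
      unfolding eigenvalue_def eigenvector_def by auto
    have "\<exists>i<n. v $ i \<noteq> 0"
      using v(1,2) by (metis carrier_vecD eq_vecI index_zero_vec(1) index_zero_vec(2))
    moreover have "(\<Sum>j<n. a i j * v $ j) = k * v $ i" if "i < n" for i
      using mult[OF that v(1)] v(1,3) that by simp
    ultimately show ?R by blast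
  next
    assume ?R
    then obtain x where x: "\<exists>i<n. x i \<noteq> 0" "\<And>i. i < n \<Longrightarrow> (\<Sum>j<n. a i j * x j) = k * x i"
      by blast
    have "vec n x \<noteq> 0\<^sub>v n"
      using x(1) by (metis index_vec index_zero_vec(1))
    moreover have "?A *\<^sub>v vec n x = k \<cdot>\<^sub>v vec n x"
    proof (rule eq_vecI)
      fix i assume "i < dim_vec (k \<cdot>\<^sub>v vec n x)"
      then show "(?A *\<^sub>v vec n x) $ i = (k \<cdot>\<^sub>v vec n x) $ i"
        using mult[of i "vec n x"] x(2)[of i] by simp
    qed simp
    ultimately show "eigenvalue ?A k"
      unfolding eigenvalue_def eigenvector_def by (intro exI[of _ "vec n x"]) auto
  qed
qed

text \<open>A complex eigenvalue always exists. The Hermitian form of a real symmetric matrix takes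
  real values, which forces this eigenvalue to be real; then the real or the imaginary part of the
  eigenvector is a real eigenvector.\<close>

lemma real_symmetric_eigenvalue_exists:
  fixes a :: "nat \<Rightarrow> nat \<Rightarrow> real"
  assumes "n > 0" and sym: "\<And>i j. a i j = a j i"
  shows "\<exists>k. eigenvalue (mat n n (\<lambda>(i, j). a i j)) k"
proof -
  let ?C = "mat n n (\<lambda>(i, j). complex_of_real (a i j))"
  obtain k where "eigenvalue ?C k"
    using spectrum_non_empty[of ?C n] \<open>n > 0\<close> unfolding spectrum_def by auto
  then obtain x where x0: "\<exists>i<n. x i \<noteq> 0"
    and x: "\<And>i. i < n \<Longrightarrow> (\<Sum>j<n. complex_of_real (a i j) * x j) = k * x i"
    unfolding eigenvalue_mat_iff by blast
  define S where "S = (\<Sum>i<n. \<Sum>j<n. cnj (x i) * complex_of_real (a i j) * x j)"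
  define N where "N = (\<Sum>i<n. (cmod (x i))\<^sup>2)"
  have "N > 0"
    unfolding N_def using x0 by (auto intro!: sum_pos2)
  have "S = (\<Sum>i<n. cnj (x i) * (\<Sum>j<n. complex_of_real (a i j) * x j))"
    unfolding S_def by (simp add: sum_distrib_left mult.assoc)
  also have "\<dots> = (\<Sum>i<n. k * complex_of_real ((cmod (x i))\<^sup>2))"
    by (intro sum.cong refl) (simp add: x complex_norm_square del: of_real_power)
  finally have S: "S = k * complex_of_real N"
    by (simp add: N_def sum_distrib_left)
  \<comment> \<open>Conjugation exchanges the roles of \<open>i\<close> and \<open>j\<close>, and
    symmetry of \<open>a\<close> restores the original sum.\<close>
  have "cnj S = (\<Sum>i<n. \<Sum>j<n. cnj (x j) * complex_of_real (a j i) * x i)"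
    unfolding S_def cnj_sum by (intro sum.cong refl) (simp add: sym mult_ac)
  also have "\<dots> = S"
    unfolding S_def by (rule sum.swap)
  finally have "cnj k = k"
    using S \<open>N > 0\<close> by simp
  then obtain r where r: "k = complex_of_real r"
    by (metis Reals_cases Reals_cnj_iff)
  have Re: "(\<Sum>j<n. a i j * Re (x j)) = r * Re (x i)"
    and Im: "(\<Sum>j<n. a i j * Im (x j)) = r * Im (x i)" if "i < n" for i
    using x[OF that] by (simp_all add: r complex_eq_iff)
  obtain i where "i < n" "Re (x i) \<noteq> 0 \<or> Im (x i) \<noteq> 0"
    using x0 by (auto simp: complex_eq_iff)
  then show ?thesis
    unfolding eigenvalue_mat_iff using Re Im by metis
qed


section \<open>Lower bound for the gap between degree and eigenvalue\<close>

lemma pcas_telescope: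
  fixes x :: "'a \<Rightarrow> real"
  assumes "pcas u p v"
  shows "x v = x u + (\<Sum>e\<leftarrow>p. x (snd e) - x (fst e))"
  using assms by (induction p arbitrary: u) auto

text \<open>Along a simple path, \<open>x v\<close> is \<open>x u\<close> plus the increments over
  the arcs. Cauchy-Schwarz applies to this sum, whose number of terms is the number of vertices on
  the path.\<close>

lemma (in pair_fin_digraph) reachable_square_le:
  fixes x :: "'a \<Rightarrow> real"
  assumes "u \<rightarrow>\<^sup>*\<^bsub>with_proj G\<^esub> v"
  shows "(x v)\<^sup>2 \<le> real (card (pverts G)) * ((x u)\<^sup>2 + (\<Sum>(a, b)\<in>parcs G. (x b - x a)\<^sup>2))"
proof -
  obtain p where p: "apath u p v"
    using assms by (auto simp: reachable_apath)
  have "distinct p" and sub: "set p \<subseteq> parcs G" and "pcas u p v"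
    using p distinct_verts_imp_distinct[of u p v] by (auto simp: apath_def awalk_def)
  define f where "f e = x (snd e) - x (fst e)" for e
  \<comment> \<open>The index \<open>None\<close> carries the starting value \<open>x u\<close>, so
    that it enters the Cauchy-Schwarz inequality on the same footing as the increments.\<close>
  define I where "I = insert None (Some ` set p)"
  define g where "g = case_option (x u) f"
  have sum_I: "sum (h \<circ> g) I = h (x u) + (\<Sum>e\<in>set p. h (f e))" for h :: "real \<Rightarrow> real"
    unfolding I_def by (subst sum.insert) (auto simp: g_def sum.reindex)
  have "x v = (\<Sum>i\<in>I. g i)"
    using pcas_telescope[OF \<open>pcas u p v\<close>, of x] sum_I[of id] \<open>distinct p\<close>
    by (simp add: sum_list_distinct_conv_sum_set f_def comp_def)
  then have "(x v)\<^sup>2 \<le> (\<Sum>i\<in>I. (g i)\<^sup>2) * card I"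
    using sum_squared_le_sum_of_squares[of g I] by simp
  also have "(\<Sum>i\<in>I. (g i)\<^sup>2) = (x u)\<^sup>2 + (\<Sum>e\<in>set p. (f e)\<^sup>2)"
    using sum_I[of "\<lambda>r. r\<^sup>2"] by (simp add: comp_def)
  also have "\<dots> * card I \<le> ((x u)\<^sup>2 + (\<Sum>e\<in>parcs G. (f e)\<^sup>2)) * card (pverts G)"
  proof (intro mult_mono add_left_mono sum_mono2 pair_finite_arcs sub)
    have "card I = Suc (length p)"
      using \<open>distinct p\<close> by (simp add: I_def card_image distinct_card)
    then show "real (card I) \<le> real (card (pverts G))"
      using length_apath_less[OF p] by simp
  qed (auto intro!: add_nonneg_nonneg sum_nonneg)
  finally show ?thesis
    by (simp add: f_def case_prod_unfold mult.commute)
qed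

lemma (in pair_fin_digraph) degree_in_eq_card: "degree_in G u = card {v. (u, v) \<in> parcs G}"
proof -
  have "out_arcs (with_proj G) u = Pair u ` {v. (u, v) \<in> parcs G}"
    by (auto simp: out_arcs_def)
  then show ?thesis
    by (simp add: out_degree_def card_image inj_on_def)
qed

text \<open>The factors 2 arise because \<open>parcs G\<close> contains each edge in both
  directions.\<close>

lemma laplacian_form:
  fixes x :: "nat \<Rightarrow> real"
  assumes "pair_graph G" and V: "pverts G = {..<n}"
  defines "a \<equiv> \<lambda>u v. of_bool ((u, v) \<in> parcs G)"
  shows "(\<Sum>(u, v)\<in>parcs G. (x v - x u)\<^sup>2) =
    2 * (\<Sum>u<n. real (degree_in G u) * (x u)\<^sup>2) - 2 * (\<Sum>u<n. x u * (\<Sum>v<n. a u v * x v))"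
proof -
  interpret pair_graph G by fact
  have sub: "parcs G \<subseteq> {..<n} \<times> {..<n}"
    by (auto simp: V[symmetric] dest: in_arcsD1 in_arcsD2)
  have deg: "real (degree_in G u) = (\<Sum>v<n. a u v)" for u
  proof -
    have "{..<n} \<inter> {v. (u, v) \<in> parcs G} = {v. (u, v) \<in> parcs G}"
      using sub by auto
    then show ?thesis
      unfolding degree_in_eq_card a_def by simp
  qed
  have sym: "a u v = a v u" for u v
    using arcs_symmetric[of u v] arcs_symmetric[of v u] by (auto simp: a_def)
  have "(\<Sum>(u, v)\<in>parcs G. (x v - x u)\<^sup>2) =
      (\<Sum>(u, v)\<in>{..<n} \<times> {..<n}. a u v * (x v - x u)\<^sup>2)"
    by (rule sum.mono_neutral_cong_left) (use sub in \<open>auto simp: a_def\<close>)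
  also have "\<dots> = (\<Sum>u<n. \<Sum>v<n. a u v * (x v - x u)\<^sup>2)"
    by (simp add: sum.cartesian_product)
  also have "\<dots> = (\<Sum>u<n. \<Sum>v<n. a u v * (x u)\<^sup>2) + (\<Sum>u<n. \<Sum>v<n. a u v * (x v)\<^sup>2)
      - 2 * (\<Sum>u<n. \<Sum>v<n. x u * (a u v * x v))"
    by (simp add: power2_diff algebra_simps sum.distrib sum_subtractf sum_distrib_left)
  also have "(\<Sum>u<n. \<Sum>v<n. a u v * (x v)\<^sup>2) = (\<Sum>u<n. \<Sum>v<n. a u v * (x u)\<^sup>2)"
    by (subst sum.swap) (simp add: sym)
  finally show ?thesis
    by (simp add: deg sum_distrib_left sum_distrib_right)
qed

lemma adj_mat_eq:
  assumes "pverts G = {..<n}"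
  shows "adj_mat G = mat n n (\<lambda>(u, v). of_bool ((u, v) \<in> parcs G))"
  by (simp add: adj_mat_def assms of_bool_def)

lemma eigenvalue_gap:
  assumes G: "pair_graph G" "Digraph_Component.connected (with_proj G)"
    and V: "pverts G = {..<n}"
    and le: "\<And>v. v < n \<Longrightarrow> degree_in G v \<le> d"
    and w: "w < n" "degree_in G w < d"
    and k: "eigenvalue (adj_mat G) k"
  shows "1 / (2 * (real n)\<^sup>2) \<le> real d - k"
proof -
  interpret pair_graph G by fact
  define a where "a u v = (of_bool ((u, v) \<in> parcs G) :: real)" for u v
  obtain x where x0: "\<exists>i<n. x i \<noteq> 0"
    and x: "\<And>i. i < n \<Longrightarrow> (\<Sum>j<n. a i j * x j) = k * x i"
    using k unfolding adj_mat_eq[OF V] eigenvalue_mat_iff a_def by blast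
  define D where "D = (\<Sum>(u, v)\<in>parcs G. (x v - x u)\<^sup>2)"
  define X where "X = (\<Sum>u<n. (x u)\<^sup>2)"
  have "D \<ge> 0"
    unfolding D_def by (auto intro: sum_nonneg)
  let ?Q = "(\<lambda>v. (x v)\<^sup>2) ` {..<n}"
  have "Max ?Q \<in> ?Q"
    using w by (intro Max_in) auto
  then obtain u where u: "u < n" "Max ?Q = (x u)\<^sup>2"
    by auto
  then have max: "(x v)\<^sup>2 \<le> (x u)\<^sup>2" if "v < n" for v
    using Max_ge[of ?Q "(x v)\<^sup>2"] that by simp
  have xu: "(x u)\<^sup>2 > 0"
    using x0 max by (metis less_le_trans zero_less_power2)
  have X: "0 \<le> X" "X \<le> real n * (x u)\<^sup>2"
    unfolding X_def using sum_bounded_above[of "{..<n}" "\<lambda>v. (x v)\<^sup>2" "(x u)\<^sup>2"] max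
    by (auto intro: sum_nonneg)
  define E where "E = (\<Sum>u<n. real (degree_in G u) * (x u)\<^sup>2)"
  have "(\<Sum>u<n. x u * (k * x u)) = k * X"
    unfolding X_def sum_distrib_left by (intro sum.cong) (auto simp: power2_eq_square)
  then have "D = 2 * E - 2 * (k * X)"
    unfolding D_def E_def laplacian_form[OF G(1) V] a_def[symmetric] by (simp add: x)
  moreover have "(\<Sum>u<n. (real d - real (degree_in G u)) * (x u)\<^sup>2) = real d * X - E"
    unfolding X_def E_def by (simp add: left_diff_distrib sum_subtractf sum_distrib_left)
  ultimately have "(real d - k) * X = (\<Sum>u<n. (real d - real (degree_in G u)) * (x u)\<^sup>2) + D / 2"
    unfolding left_diff_distrib[of "real d" k X] by linarith
  moreover have "(x w)\<^sup>2 \<le> (\<Sum>u<n. (real d - real (degree_in G u)) * (x u)\<^sup>2)"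
  proof -
    have "(x w)\<^sup>2 \<le> (real d - real (degree_in G w)) * (x w)\<^sup>2"
      using w(2) mult_right_mono[of 1 "real d - real (degree_in G w)" "(x w)\<^sup>2"] by simp
    also have "\<dots> \<le> (\<Sum>u<n. (real d - real (degree_in G u)) * (x u)\<^sup>2)"
      using w(1) le by (intro member_le_sum) auto
    finally show ?thesis .
  qed
  ultimately have "(x w)\<^sup>2 + D / 2 \<le> (real d - k) * X"
    by simp
  \<comment> \<open>Halving the first term too leaves a multiple of exactly the quantity that
    \<open>reachable_square_le\<close> bounds from below; this is the origin of the 2 in the final
    constant.\<close>
  moreover have "((x w)\<^sup>2 + D) / 2 \<le> (x w)\<^sup>2 + D / 2"
    by simp
  ultimately have lower: "((x w)\<^sup>2 + D) / 2 \<le> (real d - k) * X"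
    by (rule order.trans[rotated])
  have "w \<rightarrow>\<^sup>*\<^bsub>with_proj G\<^esub> u"
    using symmetric_connected_imp_strongly_connected[OF pair_sym_arcs G(2)] w(1) u V
    by (auto simp: strongly_connected_def)
  then have upper: "(x u)\<^sup>2 \<le> real n * ((x w)\<^sup>2 + D)"
    using reachable_square_le[of w u x] V by (simp add: D_def)
  \<comment> \<open>The sign of \<open>real d - k\<close> has to be settled before \<open>X\<close>
    can be replaced by its upper bound.\<close>
  have "0 \<le> (real d - k) * X"
    using lower \<open>D \<ge> 0\<close> by (smt (verit) zero_le_power2 divide_nonneg_nonneg)
  moreover have "X > 0"
    using xu u unfolding X_def by (intro sum_pos2[of _ u]) auto
  ultimately have "0 \<le> real d - k"
    by (simp add: zero_le_mult_iff)
  then have "(real d - k) * X \<le> (real d - k) * (real n * (x u)\<^sup>2)"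
    using X by (intro mult_left_mono) auto
  then have "((x w)\<^sup>2 + D) / 2 \<le> (real d - k) * (real n * (x u)\<^sup>2)"
    by (rule order.trans[OF lower])
  then have "(x w)\<^sup>2 + D \<le> 2 * ((real d - k) * (real n * (x u)\<^sup>2))"
    by simp
  then have "real n * ((x w)\<^sup>2 + D) \<le> real n * (2 * ((real d - k) * (real n * (x u)\<^sup>2)))"
    by (rule mult_left_mono) simp
  with upper have "(x u)\<^sup>2 * 1 \<le> (x u)\<^sup>2 * (2 * (real n)\<^sup>2 * (real d - k))"
    by (simp add: power2_eq_square mult_ac)
  then have "1 \<le> 2 * (real n)\<^sup>2 * (real d - k)"
    using xu by (simp only: mult_le_cancel_left_pos)
  then show ?thesis
    using w(1) by (simp add: divide_le_eq mult.commute)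
qed

text \<open>The real spectrum is finite and nonempty, so the \<open>Max\<close> in
  \<open>rho\<close> is attained.\<close>

lemma rho_eigenvalue:
  assumes "pair_graph G" "pverts G = {..<n}" "n > 0"
  shows "eigenvalue (adj_mat G) (rho G)"
    and "eigenvalue (adj_mat G) k \<Longrightarrow> k \<le> rho G"
proof -
  interpret pair_graph G by fact
  have "finite (spectrum (adj_mat G))"
    by (rule card_finite_spectrum(1)[of _ n]) (simp add: adj_mat_eq[OF assms(2)])
  moreover have "\<exists>k. eigenvalue (adj_mat G) k"
    unfolding adj_mat_eq[OF assms(2)]
    by (rule real_symmetric_eigenvalue_exists[OF assms(3)]) (auto dest: arcs_symmetric)
  then have "spectrum (adj_mat G) \<noteq> {}"
    by (simp add: spectrum_def)
  ultimately show "eigenvalue (adj_mat G) (rho G)" "eigenvalue (adj_mat G) k \<Longrightarrow> k \<le> rho G"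
    using Max_in[of "spectrum (adj_mat G)"] Max_ge[of "spectrum (adj_mat G)" k]
    by (auto simp: rho_def spectrum_def)
qed

section \<open>The double ladder with a pendant path\<close>

text \<open>
  For \<open>q < 4\<close>, the vertex \<open>4 j + q < 4 m\<close> belongs to position \<open>j\<close> of ladder \<open>q div 2\<close>, on the
  side given by its parity. Opposite sides are adjacent when their positions differ by at most
  one, which is the usual ladder with the two sides swapped at every other position.
  The vertices from \<open>4 m\<close> on form the path; \<open>4 m\<close> is attached to the last odd vertices
  \<open>4 m - 3\<close> and \<open>4 m - 1\<close> of the two ladders.
\<close>

definition ladder_up :: "nat \<Rightarrow> nat \<Rightarrow> nat \<Rightarrow> bool" where
  "ladder_up m v w \<longleftrightarrow> w < 4 * m \<and> even v \<and> (w = v + 1 \<or> w = v + 5)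
     \<or> w \<le> 4 * m \<and> odd v \<and> w = v + 3
     \<or> w \<ge> 4 * m \<and> w = v + 1"

definition ladder_adj :: "nat \<Rightarrow> nat \<Rightarrow> nat \<Rightarrow> bool" where
  "ladder_adj m v w \<longleftrightarrow> ladder_up m v w \<or> ladder_up m w v"

definition double_ladder :: "nat \<Rightarrow> nat \<Rightarrow> nat pair_pre_digraph" where
  "double_ladder m n = \<lparr>pverts = {..<n}, parcs = {(v, w). v < n \<and> w < n \<and> ladder_adj m v w}\<rparr>"

lemma double_ladder_simps [simp]:
  "pverts (double_ladder m n) = {..<n}"
  "(v, w) \<in> parcs (double_ladder m n) \<longleftrightarrow> v < n \<and> w < n \<and> ladder_adj m v w"
  by (simp_all add: double_ladder_def)

lemma ladder_adj_sym: "ladder_adj m v w \<longleftrightarrow> ladder_adj m w v"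
  by (auto simp: ladder_adj_def)

text \<open>Adjacent labels always differ by an odd number. This excludes loops and makes parity a
  bipartition.\<close>

lemma ladder_adj_parity: "ladder_adj m v w \<Longrightarrow> even v \<longleftrightarrow> odd w"
  by (auto simp: ladder_adj_def ladder_up_def)

lemma pair_graph_double_ladder: "pair_graph (double_ladder m n)"
proof
  have "parcs (double_ladder m n) \<subseteq> {..<n} \<times> {..<n}"
    by auto
  then show "finite (parcs (double_ladder m n))"
    by (rule finite_subset) simp
  show "symmetric (with_proj (double_ladder m n))"
    by (auto simp: symmetric_def sym_def ladder_adj_sym)
qed (use ladder_adj_parity in fastforce)+

lemma bipartite_double_ladder: "bipartite (double_ladder m n)"
  unfolding bipartite_def
  by (intro exI[of _ "{v. v < n \<and> even v}"] exI[of _ "{v. v < n \<and> odd v}"])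
    (auto dest: ladder_adj_parity)

text \<open>Only an inclusion is claimed, so truncated subtraction near vertex 0 and the repeated
  \<open>v + 1\<close> on the path do no harm.\<close>

lemma ladder_adj_neighbours:
  "\<exists>a b c. {w. ladder_adj m v w} \<subseteq> {a, b, c}"
proof -
  consider "v < 4 * m" "even v" | "v + 1 < 4 * m" "odd v" | "v + 1 = 4 * m" | "v = 4 * m" | "v > 4 * m"
    by atomize_elim presburger
  then show ?thesis
  proof cases
    case 1
    then have "{w. ladder_adj m v w} \<subseteq> {v - 3, v + 1, v + 5}"
      by (auto simp: ladder_adj_def ladder_up_def)
    then show ?thesis by blast
  next
    case 2
    then have "{w. ladder_adj m v w} \<subseteq> {v - 1, v - 5, v + 3}"
      by (auto simp: ladder_adj_def ladder_up_def)
    then show ?thesis by blast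
  next
    case 3
    then have "{w. ladder_adj m v w} \<subseteq> {v - 1, v - 5, v + 1}"
      by (auto simp: ladder_adj_def ladder_up_def) presburger
    then show ?thesis by blast
  next
    case 4
    then have "{w. ladder_adj m v w} \<subseteq> {v - 3, v - 1, v + 1}"
      by (auto simp: ladder_adj_def ladder_up_def)
    then show ?thesis by blast
  next
    case 5
    then have "{w. ladder_adj m v w} \<subseteq> {v - 1, v + 1, v + 1}"
      by (auto simp: ladder_adj_def ladder_up_def)
    then show ?thesis by blast
  qed
qed

lemma connected_double_ladder:
  assumes "4 * m < n"
  shows "Digraph_Component.connected (with_proj (double_ladder m n))"
proof -
  let ?G = "double_ladder m n"
  interpret pair_graph ?G by (rule pair_graph_double_ladder)
  have below: "v \<rightarrow>\<^sup>*\<^bsub>with_proj ?G\<^esub> (4 * m)" if "v \<le> 4 * m" for v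
    using that
  proof (induction "4 * m - v" arbitrary: v rule: less_induct)
    case less
    show ?case
    proof (cases "v = 4 * m")
      case True
      then show ?thesis using assms by auto
    next
      case False
      \<comment> \<open>Every vertex below \<open>4 * m\<close> has a larger neighbour not beyond
        \<open>4 * m\<close>: add 1 if it is even or equals \<open>4 * m - 1\<close>, and 3
        otherwise.\<close>
      then have "\<exists>w. w \<le> 4 * m \<and> v < w \<and> ladder_up m v w"
        using less.prems unfolding ladder_up_def
        by (cases "even v"; cases "v + 1 = 4 * m") (auto, presburger+)
      then obtain w where w: "w \<le> 4 * m" "v < w" "ladder_up m v w"
        by blast
      then have "(v, w) \<in> parcs ?G"
        using assms less.prems by (auto simp: ladder_adj_def)
      moreover have "w \<rightarrow>\<^sup>*\<^bsub>with_proj ?G\<^esub> (4 * m)"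
        using w less.prems by (intro less.hyps) auto
      ultimately show ?thesis
        by (rule adj_reachable_trans)
    qed
  qed
  have above: "(4 * m + t) \<rightarrow>\<^sup>*\<^bsub>with_proj ?G\<^esub> (4 * m)" if "4 * m + t < n" for t
    using that
  proof (induction t)
    case (Suc t)
    have "(4 * m + Suc t, 4 * m + t) \<in> parcs ?G"
      using Suc.prems by (auto simp: ladder_adj_def ladder_up_def)
    moreover have "(4 * m + t) \<rightarrow>\<^sup>*\<^bsub>with_proj ?G\<^esub> (4 * m)"
      using Suc by simp
    ultimately show ?case
      by (rule adj_reachable_trans)
  qed (use assms in auto)
  have to: "v \<rightarrow>\<^sup>*\<^bsub>with_proj ?G\<^esub> (4 * m)" if "v < n" for v
    using below[of v] above[of "v - 4 * m"] that by (cases "v \<le> 4 * m") auto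
  have "u \<rightarrow>\<^sup>*\<^bsub>with_proj ?G\<^esub> v" if "u < n" "v < n" for u v
    using to[OF that(1)] symmetric_reachable'[OF to[OF that(2)]] by (rule reachable_trans)
  then show ?thesis
    using assms
    by (auto simp: Digraph_Component.connected_def strongly_connected_def reachable_mk_symmetric_eq[OF pair_sym_arcs])
qed

lemma subcubic_double_ladder:
  assumes "3 \<le> m" "4 * m < n"
  shows "subcubic_bipartite (double_ladder m n)"
proof -
  let ?G = "double_ladder m n"
  interpret pair_graph ?G by (rule pair_graph_double_ladder)
  have le: "degree_in ?G v \<le> 3" for v
  proof -
    obtain a b c where "{w. ladder_adj m v w} \<subseteq> {a, b, c}"
      using ladder_adj_neighbours by blast
    then have "{w. (v, w) \<in> parcs ?G} \<subseteq> {a, b, c}"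
      by auto
    then have "degree_in ?G v \<le> card {a, b, c}"
      unfolding degree_in_eq_card by (intro card_mono) auto
    also have "\<dots> \<le> 3"
      by (simp add: card_insert_if)
    finally show ?thesis .
  qed
  have "{w. (0, w) \<in> parcs ?G} = {1, 5}"
    using assms by (auto simp: ladder_adj_def ladder_up_def)
  then have d0: "degree_in ?G 0 = 2"
    unfolding degree_in_eq_card by simp
  \<comment> \<open>Here \<open>3 \<le> m\<close> is what puts vertex 9 on a ladder.\<close>
  have "{w. (4, w) \<in> parcs ?G} = {1, 5, 9}"
    using assms by (auto simp: ladder_adj_def ladder_up_def)
  then have d4: "degree_in ?G 4 = 3"
    unfolding degree_in_eq_card by simp
  have "max_degree ?G = 3"
    unfolding max_degree_def using le d4 assms
    by (intro Max_eqI) (auto intro!: image_eqI[of _ _ 4])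
  moreover have "irregular ?G"
    unfolding irregular_def using d0 d4 assms by (intro bexI[of _ 0] bexI[of _ 4]) auto
  ultimately show ?thesis
    unfolding subcubic_bipartite_def by (simp add: pair_graph_double_ladder bipartite_double_ladder)
qed

section \<open>The antisymmetric eigenvector\<close>

text \<open>In these coordinates each ladder is the tensor product of a single edge with the path on
  \<open>m\<close> vertices carrying a loop everywhere. The loops account for the 1 and the path for
  the cosine in the eigenvalue \<open>1 + 2 * cos (pi / real (m + 1))\<close>.\<close>

lemma ladder_adj_blocks:
  assumes "j < m" "j' < m" "q < 4" "q' < 4"
  shows "ladder_adj m (4 * j + q) (4 * j' + q') \<longleftrightarrow>
    q' div 2 = q div 2 \<and> q' \<noteq> q \<and> j' \<le> j + 1 \<and> j \<le> j' + 1"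
proof -
  have up: "ladder_up m v w \<longleftrightarrow> even v \<and> (w = v + 1 \<or> w = v + 5) \<or> odd v \<and> w = v + 3"
    if "v < 4 * m" "w < 4 * m" for v w
    using that by (auto simp: ladder_up_def)
  have "4 * j + q < 4 * m" "4 * j' + q' < 4 * m"
    using assms by auto
  note adj = ladder_adj_def up[OF this] up[OF this(2,1)]
  have "q \<in> {0, 1, 2, 3}" "q' \<in> {0, 1, 2, 3}"
    using assms(3,4) by auto
  then show ?thesis
    unfolding adj by (elim insertE emptyE; simp; presburger?)
qed

text \<open>The parity of \<open>v div 2\<close> is the number of the ladder, since each position
  contributes an even amount. Positions are shifted by one so that the sine vanishes one step beyond
  either end.\<close>

definition ladder_vec :: "nat \<Rightarrow> nat \<Rightarrow> real" where
  "ladder_vec m v =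
     (if v < 4 * m then (- 1) ^ (v div 2) * sin (real (v div 4 + 1) * (pi / real (m + 1))) else 0)"

text \<open>The two vanishing boundary values let the end positions obey the same three-term formula
  as the inner ones.\<close>

lemma band_sum:
  fixes s :: "nat \<Rightarrow> real"
  assumes "j < m" "s 0 = 0" "s (m + 1) = 0"
  shows "(\<Sum>i<m. of_bool (i \<le> j + 1 \<and> j \<le> i + 1) * s (i + 1)) = s j + s (j + 1) + s (j + 2)"
proof -
  have "s j + s (j + 1) + s (j + 2) = (\<Sum>i\<in>{j, j + 1, j + 2}. s i)"
    by simp
  also have "\<dots> = (\<Sum>i<m + 2. of_bool (i \<le> j + 2 \<and> j \<le> i) * s i)"
    using assms(1) by (intro sum.mono_neutral_cong_left) auto
  also have "\<dots> = (\<Sum>i<Suc m. of_bool (i \<le> j + 2 \<and> j \<le> i) * s i)"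
    using assms(3) by simp
  also have "\<dots> = (\<Sum>i<m. of_bool (i \<le> j + 1 \<and> j \<le> i + 1) * s (i + 1))"
    using assms(2) by (subst sum.lessThan_Suc_shift) simp
  finally show ?thesis ..
qed

lemma ladder_vec_eigen:
  assumes "v < n" "4 * m < n" "m > 0"
  shows "(\<Sum>w<n. of_bool ((v, w) \<in> parcs (double_ladder m n)) * ladder_vec m w) =
    (1 + 2 * cos (pi / real (m + 1))) * ladder_vec m v"
proof -
  define \<theta> where "\<theta> = pi / real (m + 1)"
  define s where "s i = sin (real i * \<theta>)" for i
  have "real (m + 1) * \<theta> = pi"
    unfolding \<theta>_def times_divide_eq_right by (rule nonzero_mult_div_cancel_left) simp
  then have s0: "s 0 = 0" and sm: "s (m + 1) = 0"
    by (simp_all only: s_def) simp_all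
  have f: "ladder_vec m (4 * j + q) = (- 1) ^ (q div 2) * s (j + 1)" if "j < m" "q < 4" for j q
  proof -
    have "(4 * j + q) div 2 = 2 * j + q div 2" "(4 * j + q) div 4 = j" "4 * j + q < 4 * m"
      using that by presburger+
    then show ?thesis
      by (simp add: ladder_vec_def s_def \<theta>_def power_add power_mult)
  qed
  have block: "sum g {i * 4..<i * 4 + 4} = (\<Sum>q<4. g (4 * i + q))" for g :: "nat \<Rightarrow> real" and i
    using sum.shift_bounds_nat_ivl[of g 0 "i * 4" 4]
    by (simp add: atLeast0LessThan add.commute mult.commute)
  \<comment> \<open>The vector is 0 on the path, so the edges joining the ladders to vertex
    \<open>4 * m\<close> contribute nothing to the ladder rows.\<close>
  have "(\<Sum>w<n. of_bool ((v, w) \<in> parcs (double_ladder m n)) * ladder_vec m w) =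
      (\<Sum>w<m * 4. of_bool (ladder_adj m v w) * ladder_vec m w)"
    using assms by (intro sum.mono_neutral_cong_right) (auto simp: ladder_vec_def)
  also have "\<dots> = (\<Sum>i<m. \<Sum>w\<in>{i * 4..<i * 4 + 4}. of_bool (ladder_adj m v w) * ladder_vec m w)"
    by (rule sum.nat_group[symmetric])
  also have "\<dots> = (\<Sum>i<m. \<Sum>q<4. of_bool (ladder_adj m v (4 * i + q)) * ladder_vec m (4 * i + q))"
    by (simp only: block)
  finally have eq: "(\<Sum>w<n. of_bool ((v, w) \<in> parcs (double_ladder m n)) * ladder_vec m w) =
    (\<Sum>i<m. \<Sum>q<4. of_bool (ladder_adj m v (4 * i + q)) * ((- 1) ^ (q div 2) * s (i + 1)))"
    by (simp add: f)
  have four: "(\<Sum>q<4. h q) = h 0 + h 1 + h 2 + h 3" for h :: "nat \<Rightarrow> real"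
    by (simp add: numeral_eq_Suc)
  show ?thesis
  proof (cases "v < 4 * m")
    case True
    define j p where "j = v div 4" and "p = v mod 4"
    have v: "v = 4 * j + p" and j: "j < m" and p: "p < 4"
      using True by (auto simp: j_def p_def)
    have "(\<Sum>q<4. of_bool (ladder_adj m v (4 * i + q)) * ((- 1) ^ (q div 2) * s (i + 1))) =
        (- 1) ^ (p div 2) * (of_bool (i \<le> j + 1 \<and> j \<le> i + 1) * s (i + 1))" if "i < m" for i
    proof -
      have "p \<in> {0, 1, 2, 3}"
        using p by auto
      then show ?thesis
        using ladder_adj_blocks[OF j that p, of 0] ladder_adj_blocks[OF j that p, of 1]
          ladder_adj_blocks[OF j that p, of 2] ladder_adj_blocks[OF j that p, of 3]
        unfolding v four by (elim insertE emptyE; simp)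
    qed
    then have "(\<Sum>w<n. of_bool ((v, w) \<in> parcs (double_ladder m n)) * ladder_vec m w) =
        (- 1) ^ (p div 2) * (s j + s (j + 1) + s (j + 2))"
      unfolding eq by (simp add: sum_distrib_left[symmetric] band_sum[OF j s0 sm, simplified])
    also have "s j + s (j + 1) + s (j + 2) = (1 + 2 * cos \<theta>) * s (j + 1)"
    proof -
      define \<phi> where "\<phi> = real (j + 1) * \<theta>"
      have "s j = sin (\<phi> - \<theta>)" "s (j + 1) = sin \<phi>" "s (j + 2) = sin (\<phi> + \<theta>)"
        by (simp_all add: s_def \<phi>_def algebra_simps)
      then show ?thesis
        by (simp add: sin_diff sin_add algebra_simps)
    qed
    finally show ?thesis
      using f[OF j p] by (simp add: v \<theta>_def mult_ac)
  next
    case False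
    \<comment> \<open>A path vertex is adjacent to both or neither of the odd vertices at position
      \<open>i\<close>. Their values are opposite, so they cancel.\<close>
    have "(\<Sum>q<4. of_bool (ladder_adj m v (4 * i + q)) * ((- 1) ^ (q div 2) * s (i + 1))) = 0"
      if "i < m" for i
    proof -
      have "ladder_adj m v (4 * i + 1) \<longleftrightarrow> ladder_adj m v (4 * i + 3)"
        and "\<not> ladder_adj m v (4 * i)" "\<not> ladder_adj m v (4 * i + 2)"
        using False that unfolding ladder_adj_def ladder_up_def by presburger+
      then show ?thesis
        by (simp add: four)
    qed
    then show ?thesis
      using False unfolding eq by (simp add: ladder_vec_def)
  qed
qed

section \<open>Bounds for the maximum spectral radius\<close>

lemma finite_conn_subcubic_bipartite: "finite (conn_subcubic_bipartite n)"
proof (rule finite_subset)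
  show "conn_subcubic_bipartite n \<subseteq>
      (\<lambda>R. \<lparr>pverts = {..<n}, parcs = R\<rparr>) ` Pow ({..<n} \<times> {..<n})"
  proof
    fix G assume "G \<in> conn_subcubic_bipartite n"
    then have V: "pverts G = {..<n}" and "pair_graph G"
      by (auto simp: conn_subcubic_bipartite_def subcubic_bipartite_def)
    interpret pair_graph G by fact
    have "parcs G \<subseteq> {..<n} \<times> {..<n}"
      by (auto simp: V[symmetric] dest: in_arcsD1 in_arcsD2)
    moreover have "G = \<lparr>pverts = {..<n}, parcs = parcs G\<rparr>"
      using V by simp
    ultimately show "G \<in> (\<lambda>R. \<lparr>pverts = {..<n}, parcs = R\<rparr>) ` Pow ({..<n} \<times> {..<n})"
      by blast
  qed
qed simp

lemma rho_upper_bound: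
  assumes "G \<in> conn_subcubic_bipartite n"
  shows "1 / (2 * (real n)\<^sup>2) \<le> 3 - rho G"
proof -
  have V: "pverts G = {..<n}" and G: "pair_graph G" "Digraph_Component.connected (with_proj G)"
    and irr: "irregular G" and max: "max_degree G = 3"
    using assms by (auto simp: conn_subcubic_bipartite_def subcubic_bipartite_def)
  have le: "degree_in G v \<le> 3" if "v < n" for v
    using that unfolding max[symmetric] max_degree_def V by (intro Max_ge) auto
  obtain u v where "u < n" "v < n" "degree_in G u \<noteq> degree_in G v"
    using irr unfolding irregular_def V by blast
  \<comment> \<open>Two different degrees, both at most 3, cannot both equal 3.\<close>
  then obtain w where w: "w < n" "degree_in G w < 3"
    using le by (metis le_neq_implies_less)
  then have "eigenvalue (adj_mat G) (rho G)"
    by (intro rho_eigenvalue(1)[OF G(1) V]) simp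
  from eigenvalue_gap[OF G V le w this] show ?thesis
    by simp
qed

lemma rho_double_ladder:
  assumes "m > 0" "4 * m < n"
  shows "1 + 2 * cos (pi / real (m + 1)) \<le> rho (double_ladder m n)"
proof (rule rho_eigenvalue(2)[OF pair_graph_double_ladder double_ladder_simps(1)])
  \<comment> \<open>The angle lies strictly between 0 and pi, so the entry at vertex 0 is positive
    and the eigenvector is nonzero.\<close>
  have "0 < pi / real (m + 1)" "pi / real (m + 1) < pi"
    using assms(1) by (auto simp: divide_less_eq)
  then have "ladder_vec m 0 \<noteq> 0"
    using assms(1) sin_gt_zero[of "pi / real (m + 1)"] by (simp add: ladder_vec_def)
  then have "\<exists>i<n. ladder_vec m i \<noteq> 0"
    using assms(2) by (intro exI[of _ 0]) simp
  then show "eigenvalue (adj_mat (double_ladder m n)) (1 + 2 * cos (pi / real (m + 1)))"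
    unfolding adj_mat_eq[OF double_ladder_simps(1)] eigenvalue_mat_iff
    using assms ladder_vec_eigen[of _ n m] by blast
qed (use assms in auto)

text \<open>The left-hand side equals twice the square of \<open>sin (x / 2)\<close>.\<close>

lemma one_minus_cos_le: "1 - cos x \<le> x\<^sup>2 / 2" for x :: real
proof -
  have "(sin (x / 2))\<^sup>2 \<le> (x / 2)\<^sup>2"
    using abs_sin_x_le_abs_x[of "x / 2"] by (simp only: abs_le_square_iff)
  then show ?thesis
    using cos_double_sin[of "x / 2"] by (simp add: power_divide)
qed

theorem theorem1p5:
  shows "\<exists>c\<^sub>1 c\<^sub>2 :: real. \<exists>n\<^sub>0 :: nat. c\<^sub>1 > 0 \<and> c\<^sub>2 > 0 \<and>
    (\<forall>n\<ge>n\<^sub>0. c\<^sub>1 * (pi\<^sup>2 / (real n)\<^sup>2) \<le> 3 - max_rho n \<and>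
              3 - max_rho n \<le> c\<^sub>2 * (pi\<^sup>2 / (real n)\<^sup>2))"
proof (intro exI conjI allI impI)
  \<comment> \<open>The first constant cancels \<open>pi\<^sup>2\<close> in the bound
    \<open>1 / (2 * (real n)\<^sup>2)\<close>. The second is the square of the 4 in
    \<open>\<theta> \<le> 4 * pi / real n\<close>.\<close>
  show "0 < 1 / (2 * pi\<^sup>2)" and "0 < (16 :: real)"
    by simp_all
  \<comment> \<open>The threshold 13 is the least \<open>n\<close> for which the next line gives
    \<open>3 \<le> m\<close>.\<close>
  fix n :: nat assume "13 \<le> n"
  \<comment> \<open>The largest \<open>m\<close> that leaves at least one vertex for the path, which
    then has between one and four vertices.\<close>
  define m where "m = (n - 1) div 4"
  have m: "3 \<le> m" "4 * m < n" "n \<le> 4 * (m + 1)"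
    using \<open>13 \<le> n\<close> unfolding m_def by presburger+
  have mem: "double_ladder m n \<in> conn_subcubic_bipartite n"
    using m by (simp add: conn_subcubic_bipartite_def subcubic_double_ladder connected_double_ladder)
  then have "max_rho n \<in> rho ` conn_subcubic_bipartite n"
    unfolding max_rho_def using finite_conn_subcubic_bipartite by (intro Max_in) auto
  then have "1 / (2 * (real n)\<^sup>2) \<le> 3 - max_rho n"
    using rho_upper_bound by auto
  then show "1 / (2 * pi\<^sup>2) * (pi\<^sup>2 / (real n)\<^sup>2) \<le> 3 - max_rho n"
    by simp
  define \<theta> where "\<theta> = pi / real (m + 1)"
  have \<theta>: "\<theta> \<le> 4 * pi / real n"
  proof -
    have "real n \<le> 4 * real (m + 1)"
      using m(3) by linarith
    then have "pi * real n \<le> pi * (4 * real (m + 1))"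
      by (intro mult_left_mono) auto
    then show ?thesis
      using m(1,2) unfolding \<theta>_def by (simp add: divide_simps mult_ac)
  qed
  have "1 + 2 * cos \<theta> \<le> rho (double_ladder m n)"
    unfolding \<theta>_def using m by (intro rho_double_ladder) auto
  also have "\<dots> \<le> max_rho n"
    unfolding max_rho_def using mem finite_conn_subcubic_bipartite by (intro Max_ge) auto
  finally have "3 - max_rho n \<le> \<theta>\<^sup>2"
    using one_minus_cos_le[of \<theta>] by simp
  also have "\<dots> \<le> (4 * pi / real n)\<^sup>2"
    using \<theta> by (intro power_mono) (simp_all add: \<theta>_def)
  finally show "3 - max_rho n \<le> 16 * (pi\<^sup>2 / (real n)\<^sup>2)"
    by (simp add: power_divide power_mult_distrib)
qed

end
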